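(* Let $d\ge 2$, $n\ge d$ and $k\ge 1$ be integers, and put $c=\left\lceil n/\sum_{j=0}^k d^j\right\rceil$. Suppose one of the following holds: (i) $\sum_{j=0}^k d^j \mid n$ and $\gcd(d-1,n) \mid n/\sum_{j=0}^k d^j$; (ii) there is an integer $q$ with $c\equiv q \pmod{\gcd(d-1,n)}$ and $0\le q\sum_{j=0}^{k-1} d^j \le \big(\sum_{j=0}^k d^j\big)c - n$. Then $\gamma_k(G_B(n,d)) = c$, and there is a vertex $x$ of $G_B(n,d)$ such that $D=\{x,x+1,\dots,x+c-1\}$ (taken modulo $n$) is a minimum distance $k$-dominating set of $G_B(n,d)$.
   Context: The generalized de Bruijn digraph $G_B(n,d)$ has vertex set $\{0,1,\dots,n-1\}$ and an arc $(x,y)$ whenever $y\equiv dx+i \pmod n$ for some $0\le i\le d-1$ (self-loops allowed). A set $D\subseteq V(G)$ of a digraph $G$ is a distance $k$-dominating set if every vertex $v\notin D$ has some $u\in D$ with a directed path from $u$ to $v$ of length at most $k$. $\gamma_k(G)$ denotes the minimum cardinality of a distance $k$-dominating set of $G$. *)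

theory Defs
  imports
    Complex_Main
    "HOL-Number_Theory.Cong"
    "Graph_Theory.Pair_Digraph"
begin

definition gen_de_bruijn :: "nat \<Rightarrow> nat \<Rightarrow> (nat, nat \<times> nat) pre_digraph" where
  "gen_de_bruijn n d = with_proj
     \<lparr> pverts = {0..<n},
       parcs = {(x, y). x < n \<and> y < n \<and> (\<exists>i<d. [y = d * x + i] (mod n))} \<rparr>"

definition distance_dominating :: "('a, 'b) pre_digraph \<Rightarrow> nat \<Rightarrow> 'a set \<Rightarrow> bool" where
  "distance_dominating G k D \<longleftrightarrow> D \<subseteq> verts G \<and>
     (\<forall>v \<in> verts G - D. \<exists>u \<in> D. \<exists>p. pre_digraph.apath G u p v \<and> length p \<le> k)"

text \<open>Finiteness of \<open>D\<close> is required because \<open>card\<close> is 0 on infinite sets; it is automatic when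
  \<open>G\<close> has finitely many vertices.\<close>

definition distance_domination_number :: "('a, 'b) pre_digraph \<Rightarrow> nat \<Rightarrow> nat" where
  "distance_domination_number G k =
     (LEAST m. \<exists>D. distance_dominating G k D \<and> finite D \<and> card D = m)"

definition min_distance_dominating :: "('a, 'b) pre_digraph \<Rightarrow> nat \<Rightarrow> 'a set \<Rightarrow> bool" where
  "min_distance_dominating G k D \<longleftrightarrow> distance_dominating G k D \<and> finite D \<and>
     card D = distance_domination_number G k"

end

theory Submission
  imports Defs
begin

text \<open>A vertex \<open>u\<close> reaches exactly the residues of \<open>d\<^sup>j u + t\<close>, \<open>t < d\<^sup>j\<close>, by walks of length \<open>j\<close>, so it
  dominates at most \<open>\<Sum>j\<le>k. d\<^sup>j\<close> vertices; this gives the lower bound. For the upper bound, walks of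
  length \<open>j\<close> lead from the interval \<open>[x, x + c)\<close> onto an interval of length \<open>d\<^sup>j c\<close> starting at
  \<open>d\<^sup>j x\<close>. If \<open>(d - 1) x \<equiv> c - q\<close>, then the next interval starts \<open>d\<^sup>j q\<close> places before the end of this
  one, so for \<open>q \<ge> 0\<close> the intervals for \<open>j = 0, \<dots>, k\<close> leave no gap and together cover
  \<open>c (\<Sum>j\<le>k. d\<^sup>j) - q (\<Sum>j<k. d\<^sup>j) \<ge> n\<close> consecutive residues. Condition (i) is the case \<open>q = 0\<close> of
  condition (ii).\<close>

text \<open>Cutting out cycles never lengthens a walk. Domination is defined by paths, whereas the
  arithmetic below describes walks.\<close>

lemma (in wf_digraph) awalk_shorten_to_apath:
  assumes "awalk u p v"
  shows "\<exists>p'. apath u p' v \<and> length p' \<le> length p"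
  using assms
proof (induct rule: awalk_to_apath_induct)
  case (path p)
  then show ?case by (auto simp: apath_def)
next
  case (decomp p q r s)
  then have "length (q @ s) \<le> length p"
    by (auto elim!: awalk_cyc_decompE)
  then show ?case using decomp(4) order_trans by blast
qed

lemma gen_de_bruijn_simps [simp]:
  "verts (gen_de_bruijn n d) = {0..<n}"
  "arcs (gen_de_bruijn n d) = {(x, y). x < n \<and> y < n \<and> (\<exists>i<d. [y = d * x + i] (mod n))}"
  "tail (gen_de_bruijn n d) = fst"
  "head (gen_de_bruijn n d) = snd"
  by (simp_all add: gen_de_bruijn_def)

lemma wf_digraph_gen_de_bruijn: "wf_digraph (gen_de_bruijn n d)"
  by unfold_locales auto

text \<open>Induction on the length, splitting off the first arc: its choice \<open>i\<close> is the
  leading base-\<open>d\<close> digit of the offset \<open>t\<close>, and the other \<open>j\<close>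
  arcs supply the lower digits.\<close>

lemma awalk_gen_de_bruijn_iff:
  assumes "d > 0"
  shows "(\<exists>p. pre_digraph.awalk (gen_de_bruijn n d) u p v \<and> length p = j) \<longleftrightarrow>
    u < n \<and> v < n \<and> (\<exists>t<d ^ j. [v = d ^ j * u + t] (mod n))"
proof (induction j arbitrary: u)
  case 0
  interpret wf_digraph "gen_de_bruijn n d" by (rule wf_digraph_gen_de_bruijn)
  show ?case
    by (auto simp: awalk_Nil_iff cong_def)
next
  case (Suc j)
  interpret wf_digraph "gen_de_bruijn n d" by (rule wf_digraph_gen_de_bruijn)
  have "(\<exists>p. awalk u p v \<and> length p = Suc j) \<longleftrightarrow>
    (\<exists>w. u < n \<and> w < n \<and> (\<exists>i<d. [w = d * u + i] (mod n)) \<and> (\<exists>p. awalk w p v \<and> length p = j))"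
    (is "?L \<longleftrightarrow> ?R")
  proof
    assume ?L
    then obtain e p where "awalk u (e # p) v" "length p = j" by (auto simp: length_Suc_conv)
    then show ?R by (auto simp: awalk_Cons_iff) blast
  next
    assume ?R
    then obtain w i p where "u < n" "w < n" "i < d" "[w = d * u + i] (mod n)" "awalk w p v" "length p = j"
      by blast
    then have "awalk u ((u, w) # p) v \<and> length ((u, w) # p) = Suc j"
      by (auto simp: awalk_Cons_iff)
    then show ?L by blast
  qed
  also have "\<dots> \<longleftrightarrow> (\<exists>w. u < n \<and> w < n \<and> v < n \<and> (\<exists>i<d. [w = d * u + i] (mod n)) \<and>
      (\<exists>t<d ^ j. [v = d ^ j * w + t] (mod n)))"
    using Suc.IH by auto
  also have "\<dots> \<longleftrightarrow> u < n \<and> v < n \<and> (\<exists>t<d ^ Suc j. [v = d ^ Suc j * u + t] (mod n))"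
    (is "?L \<longleftrightarrow> ?R")
  proof
    assume ?L
    then obtain w i t where *: "u < n" "v < n" "i < d" "[w = d * u + i] (mod n)"
      "t < d ^ j" "[v = d ^ j * w + t] (mod n)" by blast
    have "[d ^ j * w + t = d ^ j * (d * u + i) + t] (mod n)"
      using *(4) by (intro cong_add cong_mult) auto
    with *(6) have "[v = d ^ Suc j * u + (d ^ j * i + t)] (mod n)"
      by (auto simp: algebra_simps intro: cong_trans)
    moreover have "d ^ j * i + t < d ^ Suc j"
    proof -
      have "d ^ j * i + t < d ^ j * Suc i" using *(5) by simp
      also have "\<dots> \<le> d ^ j * d" using *(3) by (intro mult_le_mono2) simp
      finally show ?thesis by (simp add: mult.commute)
    qed
    ultimately show ?R using * by blast
  next
    assume ?R
    then obtain t where *: "u < n" "v < n" "t < d ^ Suc j" "[v = d ^ Suc j * u + t] (mod n)"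
      by blast
    \<comment> \<open>The first arc uses up the leading digit \<open>t div d ^ j\<close>; the
      remainder \<open>t mod d ^ j\<close> is left for the walk from \<open>w\<close>.\<close>
    define w where "w = (d * u + t div d ^ j) mod n"
    have w: "[w = d * u + t div d ^ j] (mod n)" by (simp add: w_def)
    then have "[d ^ j * w + t mod d ^ j = d ^ j * (d * u + t div d ^ j) + t mod d ^ j] (mod n)"
      by (intro cong_add cong_mult) auto
    also have "d ^ j * (d * u + t div d ^ j) + t mod d ^ j
        = d ^ Suc j * u + (d ^ j * (t div d ^ j) + t mod d ^ j)"
      by (simp add: algebra_simps)
    also have "\<dots> = d ^ Suc j * u + t" by simp
    finally have "[v = d ^ j * w + t mod d ^ j] (mod n)"
      using *(4) cong_sym cong_trans by blast
    moreover have "t div d ^ j < d"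
      using *(3) by (simp add: less_mult_imp_div_less)
    moreover have "t mod d ^ j < d ^ j" using assms by simp
    moreover have "w < n" using *(1) by (simp add: w_def)
    ultimately show ?L using * w by blast
  qed
  finally show ?case .
qed

text \<open>Each vertex is determined by a triple: its dominator \<open>u\<close>, the length
  \<open>j\<close> of the walk, and the offset \<open>t < d ^ j\<close>. Counting triples gives the
  bound.\<close>

lemma card_distance_dominating_gen_de_bruijn:
  assumes "d > 0" and dom: "distance_dominating (gen_de_bruijn n d) k D"
  shows "n \<le> card D * (\<Sum>j\<le>k. d ^ j)"
proof -
  interpret wf_digraph "gen_de_bruijn n d" by (rule wf_digraph_gen_de_bruijn)
  have D: "D \<subseteq> {0..<n}" using dom by (simp add: distance_dominating_def)
  then have fin: "finite D" using finite_subset by blast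
  let ?I = "SIGMA u:D. SIGMA j:{..k}. {..<d ^ j}"
  have "{0..<n} \<subseteq> (\<lambda>(u, j, t). (d ^ j * u + t) mod n) ` ?I"
  proof
    fix v assume v: "v \<in> {0..<n}"
    \<comment> \<open>Members of \<open>D\<close> fit the same description, by the empty
      walk.\<close>
    have "\<exists>u\<in>D. \<exists>p. awalk u p v \<and> length p \<le> k"
    proof (cases "v \<in> D")
      case True
      with v have "awalk v [] v" by (simp add: awalk_Nil_iff)
      then show ?thesis using True by force
    next
      case False
      with v dom obtain u p where "u \<in> D" "apath u p v" "length p \<le> k"
        unfolding distance_dominating_def gen_de_bruijn_simps by blast
      then show ?thesis using awalkI_apath by blast
    qed
    then obtain u p where u: "u \<in> D" and p: "awalk u p v" "length p \<le> k" by blast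
    then obtain t where t: "t < d ^ length p" "[v = d ^ length p * u + t] (mod n)"
      using awalk_gen_de_bruijn_iff[OF assms(1), of n u v "length p"] by blast
    then have "v = (d ^ length p * u + t) mod n" using v by (simp add: cong_def)
    with u p t show "v \<in> (\<lambda>(u, j, t). (d ^ j * u + t) mod n) ` ?I"
      by (intro image_eqI[of _ _ "(u, length p, t)"]) auto
  qed
  then have "card {0..<n} \<le> card ?I"
    using fin by (intro surj_card_le) auto
  also have "\<dots> = card D * (\<Sum>j\<le>k. d ^ j)"
    using fin by simp
  finally show ?thesis by simp
qed

text \<open>If \<open>z\<close> is not below the end of the next-to-last interval, it is past the
  start of the last one; otherwise induction applies.\<close>

lemma chained_intervals_cover:
  fixes a b :: "nat \<Rightarrow> int"
  assumes "\<And>j. j < k \<Longrightarrow> a (Suc j) \<le> b j" and "a 0 \<le> z" and "z < b k"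
  shows "\<exists>j\<le>k. a j \<le> z \<and> z < b j"
  using assms
proof (induction k)
  case (Suc k)
  show ?case
  proof (cases "z < b k")
    case True
    then show ?thesis using Suc.IH Suc.prems le_SucI less_SucI by metis
  next
    case False
    then have "a (Suc k) \<le> z" using Suc.prems(1)[of k] by simp
    then show ?thesis using Suc.prems(3) by blast
  qed
qed auto

lemma interval_distance_dominating_gen_de_bruijn:
  fixes q :: int
  assumes "d > 0" and "x < n" and "q \<ge> 0"
    and x: "[(int d - 1) * int x = int c - q] (mod int n)"
    and le: "int n + q * (\<Sum>j<k. int d ^ j) \<le> int c * (\<Sum>j\<le>k. int d ^ j)"
  shows "distance_dominating (gen_de_bruijn n d) k ((\<lambda>i. (x + i) mod n) ` {0..<c})"
    (is "distance_dominating ?G k ?D")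
  unfolding distance_dominating_def
proof (intro conjI ballI)
  interpret wf_digraph ?G by (rule wf_digraph_gen_de_bruijn)
  show "?D \<subseteq> verts ?G" using \<open>x < n\<close> by auto
  fix v assume "v \<in> verts ?G - ?D"
  then have v: "v < n" by simp
  \<comment> \<open>An integer representative of \<open>d ^ j * x\<close>, from
    \<open>d ^ j - 1 = (d - 1) * (\<Sum>i<j. d ^ i)\<close> and the congruence for \<open>x\<close>.
    Integers are used since \<open>c - q\<close> may be negative.\<close>
  define a where "a j = int x + (int c - q) * (\<Sum>i<j. int d ^ i)" for j
  define b where "b j = a j + int d ^ j * int c" for j
  have a_cong: "[a j = int d ^ j * int x] (mod int n)" for j
  proof (induction j)
    case (Suc j)
    have "a (Suc j) = a j + int d ^ j * (int c - q)"
      by (simp add: a_def algebra_simps)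
    also have "[\<dots> = int d ^ j * int x + int d ^ j * ((int d - 1) * int x)] (mod int n)"
      using Suc x by (intro cong_add cong_mult cong_refl) (auto intro: cong_sym)
    finally show ?case by (simp add: algebra_simps)
  qed (simp add: a_def)
  \<comment> \<open>The representative of \<open>v\<close> in the window of \<open>n\<close>
    integers that starts at \<open>a 0 = x\<close>.\<close>
  define z where "z = int x + (int v - int x) mod int n"
  have z_cong: "[z = int v] (mod int n)"
    by (simp add: z_def cong_def mod_simps)
  have "a (Suc j) \<le> b j" for j
    using \<open>q \<ge> 0\<close> by (simp add: a_def b_def algebra_simps)
  moreover have "a 0 \<le> z" "z < int x + int n"
    using v by (simp_all add: a_def z_def)
  \<comment> \<open>The assumption \<open>le\<close> says exactly this: \<open>b k - x\<close>
    equals its right-hand side minus the \<open>q\<close> term.\<close>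
  moreover have "int x + int n \<le> b k"
    using le by (simp add: a_def b_def algebra_simps flip: lessThan_Suc_atMost)
  ultimately obtain j where j: "j \<le> k" "a j \<le> z" "z < b j"
    using chained_intervals_cover[of k a b z] by force
  \<comment> \<open>The interval from \<open>a j\<close> to \<open>b j\<close> consists of
    \<open>c\<close> blocks of length \<open>d ^ j\<close>, one per member of \<open>?D\<close>. The
    quotient of \<open>s\<close> by \<open>d ^ j\<close> picks the source, the remainder the offset
    reached from it.\<close>
  define s where "s = nat (z - a j)"
  have s: "int s = z - a j" using j by (simp add: s_def)
  have "int s < int (d ^ j * c)" using j by (simp add: s b_def)
  then have s_less: "s < c * d ^ j" by (simp only: of_nat_less_iff mult.commute)
  define u where "u = (x + s div d ^ j) mod n"
  have "s div d ^ j < c" using s_less by (simp add: less_mult_imp_div_less)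
  then have uD: "u \<in> ?D" by (auto simp: u_def)
  have "[d ^ j * u + s mod d ^ j = d ^ j * (x + s div d ^ j) + s mod d ^ j] (mod n)"
    by (intro cong_add cong_mult) (auto simp: u_def)
  also have "d ^ j * (x + s div d ^ j) + s mod d ^ j = d ^ j * x + s"
    by (simp add: distrib_left)
  finally have 1: "[d ^ j * u + s mod d ^ j = d ^ j * x + s] (mod n)" .
  have "[int (d ^ j * x + s) = a j + (z - a j)] (mod int n)"
    unfolding of_nat_add of_nat_mult of_nat_power s
    by (intro cong_add cong_refl cong_sym[OF a_cong])
  then have "[int (d ^ j * x + s) = int v] (mod int n)"
    using z_cong by (auto intro: cong_trans)
  then have "[d ^ j * x + s = v] (mod n)" by (simp only: cong_int_iff)
  with 1 have "[v = d ^ j * u + s mod d ^ j] (mod n)"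
    using cong_sym cong_trans by blast
  moreover have "s mod d ^ j < d ^ j" using \<open>d > 0\<close> by simp
  moreover have "u < n" using \<open>x < n\<close> by (simp add: u_def)
  ultimately obtain p where "awalk u p v" "length p = j"
    using awalk_gen_de_bruijn_iff[OF \<open>d > 0\<close>, of n u v j] v by blast
  then obtain p' where "apath u p' v" "length p' \<le> k"
    using awalk_shorten_to_apath j(1) order_trans by blast
  with uD show "\<exists>u\<in>?D. \<exists>p. apath u p v \<and> length p \<le> k" by blast
qed

theorem theorem2p3:
  fixes d n k c :: nat
  assumes "d \<ge> 2" and "n \<ge> d" and "k \<ge> 1"
    and "int c = \<lceil>real n / real (\<Sum>j=0..k. d ^ j)\<rceil>"
    and "((\<Sum>j=0..k. d ^ j) dvd n \<and> gcd (d - 1) n dvd n div (\<Sum>j=0..k. d ^ j)) \<or>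
         (\<exists>q::int. [int c = q] (mod int (gcd (d - 1) n)) \<and>
            0 \<le> q * (\<Sum>j=0..k-1. int d ^ j) \<and>
            q * (\<Sum>j=0..k-1. int d ^ j) \<le> (\<Sum>j=0..k. int d ^ j) * int c - int n)"
  shows "distance_domination_number (gen_de_bruijn n d) k = c \<and>
         (\<exists>x \<in> verts (gen_de_bruijn n d).
            min_distance_dominating (gen_de_bruijn n d) k ((\<lambda>i. (x + i) mod n) ` {0..<c}))"
proof -
  let ?G = "gen_de_bruijn n d"
  define S where "S = (\<Sum>j\<le>k. d ^ j)"
  define T where "T = (\<Sum>j<k. int d ^ j)"
  have S: "(\<Sum>j=0..k. d ^ j) = S" "(\<Sum>j=0..k. int d ^ j) = int S"
    by (simp_all add: S_def atLeast0AtMost)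
  have T: "(\<Sum>j=0..k-1. int d ^ j) = T"
    using \<open>k \<ge> 1\<close> by (cases k) (simp_all add: T_def atLeast0AtMost lessThan_Suc_atMost)
  have "S > 0" using \<open>d \<ge> 2\<close> by (auto simp: S_def intro!: sum_pos)
  have "T > 0" using \<open>d \<ge> 2\<close> \<open>k \<ge> 1\<close> by (auto simp: T_def lessThan_empty_iff intro!: sum_pos)
  \<comment> \<open>The ceiling makes \<open>c\<close> the least \<open>m\<close> with
    \<open>n \<le> m * S\<close>, the form in which the counting bound applies.\<close>
  have c_le: "c \<le> m" if "n \<le> m * S" for m
  proof -
    have "real n \<le> real m * real S" using that by (metis of_nat_le_iff of_nat_mult)
    then have "real n / real S \<le> real m" using \<open>S > 0\<close> by (simp add: field_simps)
    then have "int c \<le> int m" by (simp add: assms(4) S ceiling_le_iff)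
    then show ?thesis by simp
  qed
  have lower: "c \<le> card D" if "distance_dominating ?G k D" for D
    using card_distance_dominating_gen_de_bruijn[OF _ that] \<open>d \<ge> 2\<close> by (intro c_le) (simp add: S_def)
  obtain q :: int where q: "[int c = q] (mod int (gcd (d - 1) n))" "0 \<le> q * T" "q * T \<le> int S * int c - int n"
  proof (cases "S dvd n \<and> gcd (d - 1) n dvd n div S")
    case True
    then have "c = n div S"
      using assms(4) \<open>S > 0\<close> by (auto simp: S elim!: dvdE)
    with True have "[int c = 0] (mod int (gcd (d - 1) n))" "int S * int c - int n = 0"
      by (auto simp: cong_0_iff simp flip: of_nat_mult)
    then show ?thesis using that[of 0] by simp
  next
    case False
    then show ?thesis using assms(5) that unfolding S T by blast
  qed
  have "q \<ge> 0" using q(2) \<open>T > 0\<close> by (simp add: zero_le_mult_iff)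
  \<comment> \<open>With the gcd moved to the integers, the congruence for \<open>q\<close> is the
    solvability criterion for the linear congruence that defines \<open>y\<close>.\<close>
  have "gcd (int d - 1) (int n) = int (gcd (d - 1) n)"
    using \<open>d \<ge> 2\<close> by (simp add: gcd_int_int_eq[symmetric] of_nat_diff del: gcd_int_int_eq)
  then have "gcd (int d - 1) (int n) dvd int c - q"
    using q(1) by (simp add: cong_iff_dvd_diff)
  then obtain y where y: "[(int d - 1) * y = int c - q] (mod int n)"
    using cong_solve_dvd_int by blast
  define x where "x = nat (y mod int n)"
  have "n > 0" using assms by simp
  then have x: "int x = y mod int n" "x < n" by (simp_all add: x_def nat_less_iff)
  have "[(int d - 1) * int x = (int d - 1) * y] (mod int n)"
    by (simp add: x cong_def mod_simps)
  then have "[(int d - 1) * int x = int c - q] (mod int n)" using y by (rule cong_trans)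
  moreover have "int n + q * (\<Sum>j<k. int d ^ j) \<le> int c * (\<Sum>j\<le>k. int d ^ j)"
    using q(3) by (simp add: S_def T_def algebra_simps)
  ultimately have dom: "distance_dominating ?G k ((\<lambda>i. (x + i) mod n) ` {0..<c})" (is "distance_dominating _ _ ?D")
    using \<open>d \<ge> 2\<close> \<open>q \<ge> 0\<close> x(2) by (intro interval_distance_dominating_gen_de_bruijn) simp_all
  \<comment> \<open>Reduction modulo \<open>n\<close> could merge elements, but the lower bound
    applied to \<open>?D\<close> itself excludes this.\<close>
  have "card ?D = c"
    using lower[OF dom] card_image_le[of "{0..<c}" "\<lambda>i. (x + i) mod n"] by simp
  moreover from this have num: "distance_domination_number ?G k = c"
    unfolding distance_domination_number_def using dom lower
    by (intro Least_equality) auto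
  ultimately show ?thesis
    using dom x(2) by (auto simp: min_distance_dominating_def)
qed

end
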